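(* Let $k \geq 3$ be an integer, and suppose there are $k$ potential input values. Let $G$ be a network whose largest component has at most $\left( \frac{k-2}{2(k-1)} \right) |G|$ processors and whose two largest components together have at most $\frac{|G|}{2}$ processors. Then there does not exist a successful majority agreement protocol for $G$.
   Context: A network $G$ is a finite nonempty (possibly disconnected) undirected graph whose vertices are called processors; $|G|$ is the number of processors, and the size of a component (connected component) is its number of processors. The two largest components are two distinct components, possibly of equal size. Fix a set $V$ of $k$ (distinct) potential values. All processors know the whole network and the protocol. Each processor $i$ is given an input value $v_i \in V$ and may communicate without limit (and without faults), but only with the processors in its own component, after which it outputs a value in $V$. Thus a (deterministic) protocol amounts to choosing, for each processor $i$, a function giving the output of $i$ in $V$ in terms of the inputs of all the processors in the component of $i$ (and of no other inputs); these functions may be arbitrary and may differ between processors. A protocol is a successful majority agreement protocol if for every assignment of inputs $(v_i)$ there is a value $v \in V$ such that: (i) strictly more than $|G|/2$ of the processors output $v$; and (ii) if all processors have the same input $v_c$, then $v = v_c$. *)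

theory Defs
  imports Complex_Main "HOL-Library.FuncSet" "Graph_Theory.Digraph_Component"
begin

text \<open>
  An undirected graph is a symmetric digraph, as in the locale \<open>graph\<close>; its connected
  components are then its strongly connected components (\<open>sccs_verts\<close>, \<open>scc_of\<close>).
\<close>

locale network = graph +
  assumes verts_nonempty: "verts G \<noteq> {}"

abbreviation components :: "('a, 'b) pre_digraph \<Rightarrow> 'a set set" where
  "components G \<equiv> pre_digraph.sccs_verts G"

abbreviation component_of :: "('a, 'b) pre_digraph \<Rightarrow> 'a \<Rightarrow> 'a set" where
  "component_of G i \<equiv> pre_digraph.scc_of G i"

definition two_largest_components :: "('a, 'b) pre_digraph \<Rightarrow> 'a set \<Rightarrow> 'a set \<Rightarrow> bool" where
  "two_largest_components G C\<^sub>1 C\<^sub>2 \<longleftrightarrow>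
     is_arg_max card (\<lambda>C. C \<in> components G) C\<^sub>1 \<and>
     is_arg_max card (\<lambda>C. C \<in> components G - {C\<^sub>1}) C\<^sub>2"

text \<open>
  Processor \<open>i\<close> is given a function on the input assignments of its own component only;
  membership in \<open>\<rightarrow>\<^sub>E\<close> fixes the irrelevant values outside that component.
\<close>

definition protocols :: "('a, 'b) pre_digraph \<Rightarrow> 'v set \<Rightarrow> ('a \<Rightarrow> ('a \<Rightarrow> 'v) \<Rightarrow> 'v) set" where
  "protocols G V = (\<Pi> i\<in>verts G. (component_of G i \<rightarrow>\<^sub>E V) \<rightarrow> V)"

definition proc_output ::
  "('a, 'b) pre_digraph \<Rightarrow> ('a \<Rightarrow> ('a \<Rightarrow> 'v) \<Rightarrow> 'v) \<Rightarrow> ('a \<Rightarrow> 'v) \<Rightarrow> 'a \<Rightarrow> 'v" where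
  "proc_output G f inp i = f i (restrict inp (component_of G i))"

definition successful_majority_agreement ::
  "('a, 'b) pre_digraph \<Rightarrow> 'v set \<Rightarrow> ('a \<Rightarrow> ('a \<Rightarrow> 'v) \<Rightarrow> 'v) \<Rightarrow> bool" where
  "successful_majority_agreement G V f \<longleftrightarrow>
     (\<forall>inp \<in> verts G \<rightarrow> V. \<exists>v\<in>V.
        real (card {i \<in> verts G. proc_output G f inp i = v}) > real (card (verts G)) / 2 \<and>
        (\<forall>v\<^sub>c. (\<forall>i\<in>verts G. inp i = v\<^sub>c) \<longrightarrow> v = v\<^sub>c))"

end

theory Submission
  imports Defs
begin

text \<open>
  Only inputs that are constant on each component are needed. On these, the winning value \<open>W\<close> is a
  function on a product with one coordinate per component, and its tally of votes is a sum of
  contributions of the coordinates. Additivity gives two properties. Fork: from one state, changes of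
  two different coordinates cannot lead to two new distinct winners, because those two components
  would together hold more than half of the processors. Swap: exchanging one coordinate between two
  states cannot replace their winners by a disjoint set of winners.

  If some line (all coordinates but one fixed) sees three values of \<open>W\<close>, then by Fork no other
  coordinate can change anything along it, so its coordinate is a dictator. By unanimity a dictator
  makes each of the \<open>k\<close> values win against the same votes of the others, which contradicts the
  bound on the largest component. Otherwise \<open>W\<close> takes at most two values on every box, by induction
  on the number of free coordinates: Fork settles two of them and Swap three or more. But \<open>W\<close> takes
  \<open>k \<ge> 3\<close> values by unanimity.
\<close>

section \<open>Functions on a product with the Fork and Swap properties\<close>

locale fork_swap =
  fixes I :: "'i set" and W :: "('i \<Rightarrow> 's) \<Rightarrow> 'v"
  assumes finite_I: "finite I"
    and W_cong: "(\<And>i. i \<in> I \<Longrightarrow> \<sigma> i = \<tau> i) \<Longrightarrow> W \<sigma> = W \<tau>"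
    and fork: "\<lbrakk>i \<in> I; j \<in> I; i \<noteq> j; W (\<sigma>(i := a)) \<noteq> W \<sigma>; W (\<sigma>(j := b)) \<noteq> W \<sigma>\<rbrakk>
      \<Longrightarrow> W (\<sigma>(i := a)) = W (\<sigma>(j := b))"
    and swap: "l \<in> I \<Longrightarrow> {W \<sigma>, W \<tau>} \<inter> {W (\<sigma>(l := \<tau> l)), W (\<tau>(l := \<sigma> l))} \<noteq> {}"
begin

text \<open>If changing coordinate \<open>i\<close> moved the winner at
  \<open>\<sigma>(j := c)\<close>, Fork at that point would force every other winner on the
  \<open>j\<close>-line to equal the new one, so the line would see only two values.\<close>

lemma line_unchanged:
  assumes "j \<in> I" "i \<in> I" "i \<noteq> j"
    and distinct: "W \<sigma> \<noteq> W (\<sigma>(j := a))" "W \<sigma> \<noteq> W (\<sigma>(j := b))" "W (\<sigma>(j := a)) \<noteq> W (\<sigma>(j := b))"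
  shows "W (\<sigma>(j := c, i := e)) = W (\<sigma>(j := c))"
proof (rule ccontr)
  let ?s = "\<sigma>(j := c)"
  assume neq: "W (?s(i := e)) \<noteq> W ?s"
  have to: "W (\<sigma>(j := d)) = W (?s(i := e))" if "W (\<sigma>(j := d)) \<noteq> W ?s" for d
    using fork[of i j ?s e d] assms(1-3) neq that by simp
  have "W \<sigma> = W (\<sigma>(j := \<sigma> j))"
    by simp
  with to[of a] to[of b] to[of "\<sigma> j"] distinct show False
    by metis
qed

text \<open>The coordinates other than \<open>j\<close> are moved from \<open>\<sigma>\<close> to
  \<open>\<tau>\<close> one at a time. Each move preserves the whole \<open>j\<close>-line, which
  therefore stays three-valued, and \<open>line_unchanged\<close> applies again.\<close>

lemma three_on_line_imp_dictator:
  assumes j: "j \<in> I"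
    and distinct: "W \<sigma> \<noteq> W (\<sigma>(j := a))" "W \<sigma> \<noteq> W (\<sigma>(j := b))" "W (\<sigma>(j := a)) \<noteq> W (\<sigma>(j := b))"
  shows "W (\<tau>(j := c)) = W (\<sigma>(j := c))"
proof -
  have "\<forall>c. W ((override_on \<sigma> \<tau> A)(j := c)) = W (\<sigma>(j := c))" if "A \<subseteq> I - {j}" for A
  proof -
    have "finite A"
      using that finite_I finite_subset by blast
    then show ?thesis
      using that
    proof (induction A rule: finite_induct)
      case empty
      then show ?case by simp
    next
      case (insert i A)
      let ?r = "override_on \<sigma> \<tau> A"
      have i: "i \<in> I" "i \<noteq> j"
        using insert.prems by auto
      have IH: "W (?r(j := c)) = W (\<sigma>(j := c))" for c
        using insert by blast
      \<comment> \<open>\<open>?r\<close> lies on its own \<open>j\<close>-line, at position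
        \<open>\<sigma> j\<close>; so the induction hypothesis also covers \<open>?r\<close> itself,
        and its line carries the same three distinct winners.\<close>
      have "?r(j := \<sigma> j) = ?r"
        by (rule fun_upd_idem) (use insert.prems in \<open>auto simp: override_on_def\<close>)
      then have "W ?r = W \<sigma>"
        using IH[of "\<sigma> j"] by simp
      then have "W (?r(j := c, i := \<tau> i)) = W (?r(j := c))" for c
        using line_unchanged[OF j i, of ?r a b] distinct by (simp add: IH)
      moreover have "(override_on \<sigma> \<tau> (insert i A))(j := c) = ?r(j := c, i := \<tau> i)" for c
        using i by (auto simp: override_on_def)
      ultimately have "W ((override_on \<sigma> \<tau> (insert i A))(j := c)) = W (\<sigma>(j := c))" for c
        by (simp only: IH)
      then show ?case
        by blast
    qed
  qed
  moreover have "W (\<tau>(j := c)) = W ((override_on \<sigma> \<tau> (I - {j}))(j := c))"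
    by (rule W_cong) (auto simp: override_on_def)
  ultimately show ?thesis
    by simp
qed

text \<open>\<open>D\<close> is the set of free coordinates; one predicate covers all ways of fixing
  the others. "At most two values" is put as "no three pairwise distinct values".\<close>

definition two_valued_box :: "'i set \<Rightarrow> bool" where
  "two_valued_box D \<longleftrightarrow> (\<forall>x y z. (\<forall>i. i \<notin> D \<longrightarrow> x i = y i \<and> x i = z i) \<longrightarrow>
     W x = W y \<or> W x = W z \<or> W y = W z)"

lemma two_valued_boxD:
  assumes "two_valued_box (D - {i})"
    and "\<And>j. j \<notin> D \<Longrightarrow> x j = y j \<and> x j = z j"
    and "x i = y i" "x i = z i"
  shows "W x = W y \<or> W x = W z \<or> W y = W z"
  using assms unfolding two_valued_box_def by blast

lemma two_valued_square:
  assumes ij: "i \<in> I" "j \<in> I" "i \<noteq> j"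
    and boxes: "\<And>l. l \<in> {i, j} \<Longrightarrow> two_valued_box ({i, j} - {l})"
  shows "two_valued_box {i, j}"
proof -
  \<comment> \<open>Two distinct winners on one line determine the square: \<open>?s\<close> is the
    point of that line from which \<open>t\<close> differs in the other coordinate only. Its winner
    is that of \<open>p\<close> or \<open>q\<close>, and Fork at \<open>?s\<close> against the other
    one leaves no third value for \<open>t\<close>.\<close>
  have line: "W t = W p \<or> W t = W q"
    if "l \<in> {i, j}" "\<And>m. m \<noteq> l \<Longrightarrow> p m = q m" "W p \<noteq> W q"
      and t: "\<And>m. m \<notin> {i, j} \<Longrightarrow> t m = p m" for l p q t
  proof -
    define l' where "l' = (if l = i then j else i)"
    have l': "l' \<in> {i, j}" "l' \<noteq> l" "{i, j} = {l, l'}"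
      using ij that(1) by (auto simp: l'_def)
    let ?s = "p(l := t l)"
    have eqs: "t = ?s(l' := t l')" "p = ?s(l := p l)" "q = ?s(l := q l)"
      using l' that(2) t by (auto simp: fun_eq_iff)
    have "W ?s = W p \<or> W ?s = W q \<or> W p = W q"
      using two_valued_boxD[OF boxes[OF l'(1)], of ?s p q] l' that(2) by auto
    moreover have "W t = W ?s \<or> W t = W (?s(l := e))" if "W (?s(l := e)) \<noteq> W ?s" for e
    proof -
      have "l' \<in> I" "l \<in> I"
        using ij l' \<open>l \<in> {i, j}\<close> by blast+
      then have "W (?s(l' := t l')) = W ?s \<or> W (?s(l' := t l')) = W (?s(l := e))"
        using fork l'(2) that by blast
      then show ?thesis
        by (simp only: eqs(1)[symmetric])
    qed
    ultimately show ?thesis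
      using eqs(2,3) \<open>W p \<noteq> W q\<close> by metis
  qed
  show ?thesis
    unfolding two_valued_box_def
  proof (intro allI impI, rule ccontr)
    fix x y z :: "'i \<Rightarrow> 's"
    assume agree: "\<forall>m. m \<notin> {i, j} \<longrightarrow> x m = y m \<and> x m = z m"
      and distinct: "\<not> (W x = W y \<or> W x = W z \<or> W y = W z)"
    have agree: "y m = x m" "z m = x m" if "m \<notin> {i, j}" for m
      using agree that by metis+
    \<comment> \<open>The corner between \<open>x\<close> and \<open>y\<close>: the winner changes
      on the \<open>i\<close>-line from \<open>x\<close> to \<open>?m\<close> or on the
      \<open>j\<close>-line from \<open>?m\<close> to \<open>y\<close>.\<close>
    let ?m = "x(i := y i)"
    show False
    proof (cases "W ?m = W x")
      case False
      have "W y = W x \<or> W y = W ?m" "W z = W x \<or> W z = W ?m"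
        by (rule line[of i]; use False agree in simp)+
      then show False
        using distinct by metis
    next
      case True
      then have "W z = W ?m \<or> W z = W y"
        by (intro line[of j]) (use agree distinct in auto)
      then show False
        using distinct True by metis
    qed
  qed
qed

text \<open>Three winners in the box would yield points \<open>q\<close> and \<open>r\<close> with
  distinct winners such that exchanging one coordinate gives both the remaining third winner,
  against Swap. Slabs (one coordinate of \<open>D\<close> fixed) are two-valued by
  hypothesis.\<close>

lemma two_valued_box_step:
  assumes "D \<subseteq> I" "card D \<ge> 3"
    and boxes: "\<And>l. l \<in> D \<Longrightarrow> two_valued_box (D - {l})"
  shows "two_valued_box D"
  unfolding two_valued_box_def
proof (intro allI impI, rule ccontr)
  fix x y z :: "'i \<Rightarrow> 's"
  assume agree: "\<forall>i. i \<notin> D \<longrightarrow> x i = y i \<and> x i = z i"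
    and distinct: "\<not> (W x = W y \<or> W x = W z \<or> W y = W z)"
  define B where "B = {t. \<forall>m. m \<notin> D \<longrightarrow> t m = x m}"
  have slab: "W p = W q \<or> W p = W r \<or> W q = W r"
    if "l \<in> D" "p \<in> B" "q \<in> B" "r \<in> B" "p l = q l" "p l = r l" for l p q r
    using two_valued_boxD[OF boxes[OF that(1)], of p q r] that unfolding B_def by auto
  have upd: "p(l := e) \<in> B" if "p \<in> B" "l \<in> D" for p l e
    using that unfolding B_def by auto
  have xyz: "x \<in> B" "y \<in> B" "z \<in> B"
    using agree unfolding B_def by auto
  have other: "\<exists>l. l \<in> D \<and> l \<notin> A" if "finite A" "card A \<le> 2" for A
    using assms(2) that by (metis card_mono not_less_eq_eq numeral_2_eq_2 numeral_3_eq_3 order_trans subsetI)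
  obtain i p q where i: "i \<in> D" and pq: "p \<in> B" "q \<in> B" "p i = q i" "W p \<noteq> W q"
  proof -
    obtain i where "i \<in> D"
      using other[of "{}"] by auto
    moreover obtain j where "j \<in> D" "j \<noteq> i"
      using other[of "{i}"] by auto
    ultimately have ij: "i \<in> D" "j \<in> D" "j \<noteq> i" .
    let ?m = "x(i := y i)"
    show thesis
    proof (cases "W ?m = W x")
      case True
      then show thesis
        using that[OF ij(1), of ?m y] upd xyz ij distinct by auto
    next
      case False
      then show thesis
        using that[OF ij(2), of ?m x] upd xyz ij by auto
    qed
  qed
  obtain r where r: "r \<in> B" "W r \<noteq> W p" "W r \<noteq> W q"
    using xyz distinct by metis
  let ?g = "r(i := p i)"
  have g: "?g \<in> B"
    using upd r i by simp
  have g_cases: "W ?g = W p \<or> W ?g = W q"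
    using slab[OF i g pq(1,2)] pq by auto
  then have rg: "W r \<noteq> W ?g"
    using r by auto
  \<comment> \<open>The name \<open>q\<close> now denotes whichever of the old \<open>p\<close> and
    \<open>q\<close> has a winner other than that of \<open>?g\<close>.\<close>
  from g_cases obtain q where q: "q \<in> B" "q i = p i" "W q \<noteq> W ?g" "W q \<noteq> W r"
    and slab_i: "\<And>h. h \<in> B \<Longrightarrow> h i = p i \<Longrightarrow> W h = W ?g \<or> W h = W q"
  proof (elim disjE)
    assume *: "W ?g = W p"
    have "W h = W p \<or> W h = W q" if "h \<in> B" "h i = p i" for h
      using slab[OF i that(1) pq(1,2)] that pq by auto
    with * show thesis using that[of q] pq r by auto
  next
    assume *: "W ?g = W q"
    have "W h = W p \<or> W h = W q" if "h \<in> B" "h i = p i" for h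
      using slab[OF i that(1) pq(1,2)] that pq by auto
    with * show thesis using that[of p] pq r by auto
  qed
  \<comment> \<open>Such an \<open>h\<close> lies in two slabs, with winners
    \<open>{W ?g, W q}\<close> and \<open>{W ?g, W r}\<close>, which share only
    \<open>W ?g\<close>.\<close>
  have meet: "W h = W ?g" if "h \<in> B" "h i = p i" "j \<in> D" "j \<noteq> i" "h j = r j" for h j
    using slab[OF that(3) that(1) g r(1)] slab_i[OF that(1,2)] that q rg by auto
  obtain l where l: "l \<in> D" "l \<noteq> i"
    using other[of "{i}"] by auto
  \<comment> \<open>Here three free coordinates are essential: \<open>?v\<close> leaves the slab of
    \<open>p\<close> in \<open>i\<close>, and the slabs in \<open>j\<close> and \<open>l\<close>
    together pin down its winner.\<close>
  obtain j where j: "j \<in> D" "j \<noteq> i" "j \<noteq> l"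
    using other[of "{i, l}"] l by (auto simp: card_insert_if)
  let ?u = "q(l := r l)" and ?v = "r(l := q l)" and ?w = "q(j := r j)"
  have "W ?u = W ?g"
    using meet[of ?u l] upd q l by auto
  moreover have "W ?v = W ?g"
  proof -
    have "W ?w = W ?g"
      using meet[of ?w j] upd q j by auto
    moreover have "W ?v = W ?g \<or> W ?v = W r"
      using slab[of j ?v ?g r] upd r g l j rg by auto
    moreover have "W ?v = W q \<or> W ?v = W ?w \<or> W q = W ?w"
      using slab[of l ?v q ?w] upd r q l j by auto
    ultimately show ?thesis
      using q by metis
  qed
  ultimately show False
    using swap[of l q r] l assms(1) q rg by auto
qed

lemma two_valued_if_lines:
  assumes lines: "\<And>j. j \<in> I \<Longrightarrow> two_valued_box {j}"
  shows "D \<subseteq> I \<Longrightarrow> two_valued_box D"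
proof (induction "card D" arbitrary: D rule: less_induct)
  case less
  have fin: "finite D"
    using less.prems finite_I finite_subset by blast
  have IH: "two_valued_box (D - {l})" if "l \<in> D" for l
    using less.hyps[of "D - {l}"] less.prems fin that by (meson Diff_subset card_Diff1_less subset_trans)
  consider "card D = 0" | "card D = 1" | "card D = 2" | "card D \<ge> 3"
    by linarith
  then show ?case
  proof cases
    case 1
    then have "D = {}"
      using fin by simp
    moreover have "two_valued_box {}"
      unfolding two_valued_box_def by (metis empty_iff ext)
    ultimately show ?thesis
      by simp
  next
    case 2
    then show ?thesis
      using lines less.prems by (auto simp: card_1_singleton_iff)
  next
    case 3
    then obtain i j where D: "D = {i, j}" "i \<noteq> j"
      by (auto simp: card_2_iff)
    show ?thesis
      unfolding D(1) by (rule two_valued_square) (use D less.prems IH in blast)+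
  next
    case 4
    then show ?thesis
      using two_valued_box_step less.prems IH by blast
  qed
qed

theorem dictator_or_two_valued:
  "(\<exists>j\<in>I. \<forall>\<sigma> \<tau>. \<sigma> j = \<tau> j \<longrightarrow> W \<sigma> = W \<tau>) \<or> (\<forall>x y z. W x = W y \<or> W x = W z \<or> W y = W z)"
proof (cases "\<forall>j\<in>I. two_valued_box {j}")
  case True
  then have box: "two_valued_box I"
    using two_valued_if_lines by blast
  have "W x = W y \<or> W x = W z \<or> W y = W z" for x y z
  proof -
    \<comment> \<open>Arbitrary arguments may differ outside \<open>I\<close>, where
      \<open>W\<close> does not look; overriding puts them into a single box with free set
      \<open>I\<close>.\<close>
    have "W (override_on x t I) = W t" for t
      by (rule W_cong) auto
    then show ?thesis
      using box[unfolded two_valued_box_def, rule_format, of x "override_on x y I" "override_on x z I"]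
      by auto
  qed
  then show ?thesis
    by blast
next
  case False
  then obtain j x y z where j: "j \<in> I" and agree: "\<forall>i. i \<noteq> j \<longrightarrow> x i = y i \<and> x i = z i"
    and distinct: "W x \<noteq> W y" "W x \<noteq> W z" "W y \<noteq> W z"
    unfolding two_valued_box_def by auto
  have "y = x(j := y j)" "z = x(j := z j)"
    using agree by (auto simp: fun_eq_iff)
  then have "W (\<tau>(j := c)) = W (x(j := c))" for \<tau> c
    using three_on_line_imp_dictator[OF j] distinct by metis
  then have "W \<sigma> = W \<tau>" if "\<sigma> j = \<tau> j" for \<sigma> \<tau>
    using that by (metis fun_upd_triv)
  then show ?thesis
    using j by blast
qed

end

section \<open>Tallies of additive votes\<close>

locale weighted_majority =
  fixes I :: "'i set" and V :: "'v set" and weight :: "'i \<Rightarrow> real"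
    and votes :: "'i \<Rightarrow> 's \<Rightarrow> 'v \<Rightarrow> real" and W :: "('i \<Rightarrow> 's) \<Rightarrow> 'v"
  assumes finite_I: "finite I"
    and finite_V: "finite V"
    and votes_nonneg: "votes i a v \<ge> 0"
    and sum_votes: "i \<in> I \<Longrightarrow> (\<Sum>v\<in>V. votes i a v) = weight i"
    and W_in_V: "W \<sigma> \<in> V"
    and majority: "(\<Sum>i\<in>I. votes i (\<sigma> i) (W \<sigma>)) > sum weight I / 2"
begin

definition tally :: "('i \<Rightarrow> 's) \<Rightarrow> 'v \<Rightarrow> real" where
  "tally \<sigma> v = (\<Sum>i\<in>I. votes i (\<sigma> i) v)"

lemma tally_nonneg: "tally \<sigma> v \<ge> 0"
  unfolding tally_def by (intro sum_nonneg votes_nonneg)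

lemma majority_tally: "tally \<sigma> (W \<sigma>) > sum weight I / 2"
  using majority unfolding tally_def .

lemma sum_tally: "(\<Sum>v\<in>V. tally \<sigma> v) = sum weight I"
  unfolding tally_def by (subst sum.swap) (simp add: sum_votes)

lemma sum_tally_le: "A \<subseteq> V \<Longrightarrow> sum (tally \<sigma>) A \<le> sum weight I"
  using sum_mono2[OF finite_V, of A "tally \<sigma>"] sum_tally[of \<sigma>] tally_nonneg by simp

lemma W_unique: "v \<in> V \<Longrightarrow> tally \<sigma> v > sum weight I / 2 \<Longrightarrow> W \<sigma> = v"
  using sum_tally_le[of "{v, W \<sigma>}" \<sigma>] majority_tally[of \<sigma>] W_in_V[of \<sigma>] by (cases "W \<sigma> = v") auto

lemma tally_upd: "i \<in> I \<Longrightarrow> tally (\<sigma>(i := a)) v = tally \<sigma> v - votes i (\<sigma> i) v + votes i a v"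
proof -
  assume i: "i \<in> I"
  have "(\<Sum>j\<in>I - {i}. votes j ((\<sigma>(i := a)) j) v) = (\<Sum>j\<in>I - {i}. votes j (\<sigma> j) v)"
    by (rule sum.cong) auto
  then show ?thesis
    unfolding tally_def using sum.remove[OF finite_I i, of "\<lambda>j. votes j (\<sigma> j) v"]
      sum.remove[OF finite_I i, of "\<lambda>j. votes j ((\<sigma>(i := a)) j) v"] by simp
qed

lemma votes_le_weight: "i \<in> I \<Longrightarrow> v \<in> V \<Longrightarrow> votes i a v \<le> weight i"
  using member_le_sum[of v V "votes i a"] finite_V votes_nonneg sum_votes[of i a] by simp

text \<open>One coordinate can raise a tally by at most its weight, so a value that wins after the
  change was already this close to a majority.\<close>

lemma tally_near_majority:
  assumes "i \<in> I"
  shows "tally \<sigma> (W (\<sigma>(i := a))) > sum weight I / 2 - weight i"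
  using majority_tally[of "\<sigma>(i := a)"] tally_upd[OF assms, of \<sigma> a] votes_nonneg[of i "\<sigma> i"]
    votes_le_weight[OF assms W_in_V] by (smt (verit, best))

text \<open>Three distinct winners would have tallies at \<open>\<sigma>\<close> above one half, one
  half minus \<open>weight i\<close> and one half minus \<open>weight j\<close> of the total, hence
  together more than the total.\<close>

lemma W_fork:
  assumes "i \<in> I" "j \<in> I" "weight i + weight j \<le> sum weight I / 2"
    and "W (\<sigma>(i := a)) \<noteq> W \<sigma>" "W (\<sigma>(j := b)) \<noteq> W \<sigma>"
  shows "W (\<sigma>(i := a)) = W (\<sigma>(j := b))"
proof (rule ccontr)
  assume neq: "W (\<sigma>(i := a)) \<noteq> W (\<sigma>(j := b))"
  have "sum (tally \<sigma>) {W \<sigma>, W (\<sigma>(i := a)), W (\<sigma>(j := b))} \<le> sum weight I"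
    by (rule sum_tally_le) (simp add: W_in_V)
  moreover have "sum (tally \<sigma>) {W \<sigma>, W (\<sigma>(i := a)), W (\<sigma>(j := b))} =
      tally \<sigma> (W \<sigma>) + tally \<sigma> (W (\<sigma>(i := a))) + tally \<sigma> (W (\<sigma>(j := b)))"
    using assms(4,5) neq by auto
  ultimately show False
    using majority_tally[of \<sigma>] tally_near_majority[OF assms(1), of \<sigma> a]
      tally_near_majority[OF assms(2), of \<sigma> b] assms(3) by linarith
qed

text \<open>
  Exchanging one coordinate between \<open>\<sigma>\<close> and \<open>\<tau>\<close> preserves the sum of the two tallies, whose
  total is \<open>2 * sum weight I\<close>; a disjoint pair of winner sets would exceed it.
\<close>

lemma W_swap:
  assumes l: "l \<in> I"
  shows "{W \<sigma>, W \<tau>} \<inter> {W (\<sigma>(l := \<tau> l)), W (\<tau>(l := \<sigma> l))} \<noteq> {}"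
proof
  let ?\<sigma> = "\<sigma>(l := \<tau> l)" and ?\<tau> = "\<tau>(l := \<sigma> l)"
  let ?A = "{W \<sigma>, W \<tau>}" and ?B = "{W ?\<sigma>, W ?\<tau>}"
  assume disj: "?A \<inter> ?B = {}"
  have large: "sum (\<lambda>v. tally \<rho> v + tally \<rho>' v) {W \<rho>, W \<rho>'} > sum weight I" for \<rho> \<rho>'
  proof -
    have "tally \<rho> (W \<rho>) \<le> sum (tally \<rho>) {W \<rho>, W \<rho>'}" "tally \<rho>' (W \<rho>') \<le> sum (tally \<rho>') {W \<rho>, W \<rho>'}"
      by (rule member_le_sum; simp add: tally_nonneg)+
    then show ?thesis
      using majority_tally[of \<rho>] majority_tally[of \<rho>'] by (simp only: sum.distrib)
  qed
  have eq: "tally ?\<sigma> v + tally ?\<tau> v = tally \<sigma> v + tally \<tau> v" for v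
    by (simp add: tally_upd[OF l])
  have "sum (\<lambda>v. tally \<sigma> v + tally \<tau> v) ?A + sum (\<lambda>v. tally \<sigma> v + tally \<tau> v) ?B =
      sum (\<lambda>v. tally \<sigma> v + tally \<tau> v) (?A \<union> ?B)"
    by (rule sum.union_disjoint[symmetric]) (use disj in auto)
  also have "\<dots> \<le> 2 * sum weight I"
    using sum_tally_le[of "?A \<union> ?B" \<sigma>] sum_tally_le[of "?A \<union> ?B" \<tau>] W_in_V
    by (simp only: sum.distrib) auto
  finally show False
    using large[of \<sigma> \<tau>] large[of ?\<sigma> ?\<tau>] by (simp only: eq)
qed

lemma fork_swap_W:
  assumes "\<And>i j. \<lbrakk>i \<in> I; j \<in> I; i \<noteq> j\<rbrakk> \<Longrightarrow> weight i + weight j \<le> sum weight I / 2"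
  shows "fork_swap I W"
proof
  \<comment> \<open>Two values cannot both exceed half, so the tally determines the winner.\<close>
  show "W \<sigma> = W \<tau>" if "\<And>i. i \<in> I \<Longrightarrow> \<sigma> i = \<tau> i" for \<sigma> \<tau>
  proof -
    have "tally \<sigma> = tally \<tau>"
      using that by (auto simp: tally_def fun_eq_iff intro!: sum.cong)
    then show ?thesis
      using W_unique[OF W_in_V, of \<sigma> \<tau>] majority_tally[of \<tau>] by simp
  qed
  show "W (\<sigma>(i := a)) = W (\<sigma>(j := b))"
    if "i \<in> I" "j \<in> I" "i \<noteq> j" "W (\<sigma>(i := a)) \<noteq> W \<sigma>" "W (\<sigma>(j := b)) \<noteq> W \<sigma>"
    for i j \<sigma> a b
    using W_fork assms that by blast
qed (fact finite_I W_swap)+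

text \<open>Each value can win on this line, so the other coordinates alone give it more than half
  the total minus \<open>weight i\<close>. Summing over \<open>V\<close> bounds this by the votes
  they have, the total minus \<open>weight i\<close>.\<close>

lemma line_range_weight:
  assumes i: "i \<in> I" and onto: "\<And>v. v \<in> V \<Longrightarrow> \<exists>a. W (\<sigma>(i := a)) = v" and "V \<noteq> {}"
  shows "sum weight I / 2 * card V < sum weight I + (real (card V) - 1) * weight i"
proof -
  have "sum weight I / 2 - weight i < tally \<sigma> v - votes i (\<sigma> i) v" if v: "v \<in> V" for v
  proof -
    obtain a where "W (\<sigma>(i := a)) = v"
      using onto v by blast
    then show ?thesis
      using majority_tally[of "\<sigma>(i := a)"] tally_upd[OF i, of \<sigma> a v] votes_le_weight[OF i v, of a] by simp
  qed
  then have "(\<Sum>v\<in>V. sum weight I / 2 - weight i) < (\<Sum>v\<in>V. tally \<sigma> v - votes i (\<sigma> i) v)"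
    by (intro sum_strict_mono finite_V assms(3))
  then show ?thesis
    by (simp add: sum_subtractf sum_tally sum_votes[OF i] algebra_simps)
qed

end

section \<open>Component sizes and counting outputs by component\<close>

lemma card_le_largest_component:
  assumes "two_largest_components G C\<^sub>1 C\<^sub>2" "C \<in> components G"
  shows "card C \<le> card C\<^sub>1"
  using assms unfolding two_largest_components_def is_arg_max_def by (auto simp: not_less)

lemma card_add_le_two_largest_components:
  assumes "two_largest_components G C\<^sub>1 C\<^sub>2" "C \<in> components G" "D \<in> components G" "C \<noteq> D"
  shows "card C + card D \<le> card C\<^sub>1 + card C\<^sub>2"
proof -
  have "card X \<le> card C\<^sub>2" if "X \<in> components G" "X \<noteq> C\<^sub>1" for X
    using assms(1) that unfolding two_largest_components_def is_arg_max_def by (auto simp: not_less)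
  then show ?thesis
    using card_le_largest_component[OF assms(1)] assms(2-4) by (metis add.commute add_mono)
qed

context network
begin

lemma mem_component: "C \<in> components G \<Longrightarrow> i \<in> C \<Longrightarrow> i \<in> verts G \<and> component_of G i = C"
  using sccs_verts_subsets scc_of_eq by (auto simp: sccs_verts_conv_scc_of)

lemma finite_component: "C \<in> components G \<Longrightarrow> finite C"
  using finite_subset sccs_verts_subsets finite_verts by blast

lemma card_verts_filter:
  "card {i \<in> verts G. P i} = (\<Sum>C\<in>components G. card {i \<in> C. P i})"
proof -
  have "{i \<in> verts G. P i} = (\<Union>C\<in>components G. {i \<in> C. P i})"
    using mem_component in_scc_of_self scc_of_in_sccs_verts by blast
  moreover have "card (\<Union>C\<in>components G. {i \<in> C. P i}) = (\<Sum>C\<in>components G. card {i \<in> C. P i})"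
  proof (rule card_UN_disjoint)
    show "\<forall>C\<in>components G. finite {i \<in> C. P i}"
      using finite_component by simp
    show "\<forall>C\<in>components G. \<forall>D\<in>components G. C \<noteq> D \<longrightarrow> {i \<in> C. P i} \<inter> {i \<in> D. P i} = {}"
      using sccs_verts_disjoint by blast
  qed (rule finite_sccs_verts)
  ultimately show ?thesis
    by simp
qed

text \<open>Locality of the protocol enters here: with inputs constant on components, the votes
  split into one term per component, depending only on the input there.\<close>

lemma card_filter_proc_output:
  "card {i \<in> verts G. proc_output G f (\<lambda>i. \<rho> (component_of G i)) i = v} =
     (\<Sum>C\<in>components G. card {i \<in> C. f i (restrict (\<lambda>_. \<rho> C) C) = v})"
proof -
  have "restrict (\<lambda>i. \<rho> (component_of G i)) C = restrict (\<lambda>_. \<rho> C) C" if "C \<in> components G" for C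
    using mem_component[OF that] by (auto simp: restrict_def)
  then have "proc_output G f (\<lambda>i. \<rho> (component_of G i)) i = f i (restrict (\<lambda>_. \<rho> C) C)"
    if "C \<in> components G" "i \<in> C" for C i
    using mem_component[OF that] that by (simp add: proc_output_def)
  then show ?thesis
    by (subst card_verts_filter) (auto intro!: sum.cong arg_cong[where f = card])
qed

end

section \<open>Reduction of a protocol to weighted majority voting\<close>

theorem theorem3:
  fixes G :: "('a, 'b) pre_digraph"
    and V :: "'v set"
    and k :: nat
    and C\<^sub>1 C\<^sub>2 :: "'a set"
  assumes "network G"
    and "k \<ge> 3"
    and "card V = k"
    and "two_largest_components G C\<^sub>1 C\<^sub>2"
    and "real (card C\<^sub>1) \<le> (real k - 2) / (2 * (real k - 1)) * real (card (verts G))"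
    and "real (card C\<^sub>1) + real (card C\<^sub>2) \<le> real (card (verts G)) / 2"
  shows "\<not> (\<exists>f \<in> protocols G V. successful_majority_agreement G V f)"
proof
  interpret network G by fact
  assume "\<exists>f \<in> protocols G V. successful_majority_agreement G V f"
  then obtain f where f: "f \<in> protocols G V" and succ: "successful_majority_agreement G V f"
    by blast
  have finite_V: "finite V"
    using assms(2,3) card.infinite by fastforce
  have "V \<noteq> {}"
    using assms(2,3) by auto
  then obtain v\<^sub>0 where v0: "v\<^sub>0 \<in> V"
    by blast
  \<comment> \<open>States range over the whole type; this retraction onto \<open>V\<close> makes
    every state an admissible input.\<close>
  define r where "r a = (if a \<in> V then a else v\<^sub>0)" for a
  have r: "r a \<in> V" "a \<in> V \<Longrightarrow> r a = a" for a
    using v0 by (auto simp: r_def)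
  define votes where
    "votes C a v = real (card {i \<in> C. f i (restrict (\<lambda>_. r a) C) = v})" for C a v
  let ?n = "real (card (verts G))" and ?weight = "\<lambda>C. real (card C)"
  have total: "sum ?weight (components G) = ?n"
    using card_verts_filter[of "\<lambda>_. True"] by simp
  have count: "real (card {i \<in> verts G. proc_output G f (\<lambda>i. r (\<sigma> (component_of G i))) i = v}) =
      (\<Sum>C\<in>components G. votes C (\<sigma> C) v)" for \<sigma> v
    using card_filter_proc_output[of f "\<lambda>C. r (\<sigma> C)" v] by (simp add: votes_def)
  have "\<exists>v\<in>V. (\<Sum>C\<in>components G. votes C (\<sigma> C) v) > ?n / 2 \<and>
      (\<forall>c\<in>V. (\<forall>C\<in>components G. \<sigma> C = c) \<longrightarrow> v = c)" for \<sigma>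
  proof -
    have "(\<lambda>i. r (\<sigma> (component_of G i))) \<in> verts G \<rightarrow> V"
      using r by auto
    then obtain v where v: "v \<in> V" "(\<Sum>C\<in>components G. votes C (\<sigma> C) v) > ?n / 2"
      "\<And>c. \<forall>i\<in>verts G. r (\<sigma> (component_of G i)) = c \<Longrightarrow> v = c"
      using succ unfolding successful_majority_agreement_def count[symmetric] by meson
    have "v = c" if "c \<in> V" "\<forall>C\<in>components G. \<sigma> C = c" for c
      by (rule v(3)) (use that r scc_of_in_sccs_verts in auto)
    with v show ?thesis
      by blast
  qed
  then obtain W where W: "\<And>\<sigma>. W \<sigma> \<in> V"
      "\<And>\<sigma>. (\<Sum>C\<in>components G. votes C (\<sigma> C) (W \<sigma>)) > ?n / 2"
      "\<And>\<sigma> c. c \<in> V \<Longrightarrow> \<forall>C\<in>components G. \<sigma> C = c \<Longrightarrow> W \<sigma> = c"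
    by metis
  have sum_votes: "(\<Sum>v\<in>V. votes C a v) = ?weight C" if C: "C \<in> components G" for C a
  proof -
    have "f i (restrict (\<lambda>_. r a) C) \<in> V" if "i \<in> C" for i
    proof -
      have "f i \<in> (component_of G i \<rightarrow>\<^sub>E V) \<rightarrow> V"
        using f mem_component[OF C that] unfolding protocols_def by blast
      then show ?thesis
        using mem_component[OF C that] r by auto
    qed
    then have "C = (\<Union>v\<in>V. {i \<in> C. f i (restrict (\<lambda>_. r a) C) = v})"
      by auto
    then have "card C = (\<Sum>v\<in>V. card {i \<in> C. f i (restrict (\<lambda>_. r a) C) = v})"
      using card_UN_disjoint[of V "\<lambda>v. {i \<in> C. f i (restrict (\<lambda>_. r a) C) = v}"]
        finite_V finite_component[OF C] by auto
    then show ?thesis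
      by (simp add: votes_def)
  qed
  interpret weighted_majority "components G" V ?weight votes W
    by unfold_locales (use finite_sccs_verts finite_V sum_votes W total in \<open>auto simp: votes_def\<close>)
  interpret fork_swap "components G" W
  proof (rule fork_swap_W)
    fix C D assume "C \<in> components G" "D \<in> components G" "C \<noteq> D"
    then have "card C + card D \<le> card C\<^sub>1 + card C\<^sub>2"
      using card_add_le_two_largest_components[OF assms(4)] by blast
    then show "?weight C + ?weight D \<le> sum ?weight (components G) / 2"
      using assms(6) total by linarith
  qed
  have unanimous: "W (\<lambda>_. c) = c" if "c \<in> V" for c
    using W(3) that by simp
  obtain a b c where "{a, b, c} \<subseteq> V" "a \<noteq> b" "a \<noteq> c" "b \<noteq> c"
    using obtain_subset_with_card_n[of 3 V] assms(2,3) by (metis card_3_iff)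
  then have "\<not> (\<forall>x y z. W x = W y \<or> W x = W z \<or> W y = W z)"
    using unanimous by (metis insert_subset)
  then obtain C where C: "C \<in> components G" and dict: "\<And>\<sigma> \<tau>. \<sigma> C = \<tau> C \<Longrightarrow> W \<sigma> = W \<tau>"
    using dictator_or_two_valued by blast
  \<comment> \<open>The state with \<open>v\<close> at \<open>C\<close> agrees there with the
    constant state \<open>v\<close>, whose winner is \<open>v\<close> by unanimity.\<close>
  have "\<exists>a. W ((\<lambda>_. v\<^sub>0)(C := a)) = v" if "v \<in> V" for v
    using dict[of "(\<lambda>_. v\<^sub>0)(C := v)" "\<lambda>_. v"] unanimous[OF that] by auto
  then have "?n / 2 * k < ?n + (real k - 1) * ?weight C"
    using line_range_weight[OF C, of "\<lambda>_. v\<^sub>0"] \<open>V \<noteq> {}\<close> total assms(3) by simp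
  moreover have "(real k - 1) * ?weight C \<le> (real k - 2) / 2 * ?n"
  proof -
    have "?weight C \<le> (real k - 2) / (2 * (real k - 1)) * ?n"
      using card_le_largest_component[OF assms(4) C] assms(5) by linarith
    then show ?thesis
      using assms(2) by (simp add: field_simps)
  qed
  \<comment> \<open>Both sides equal \<open>k * ?n / 2\<close>, so the bound on the largest
    component is exactly what excludes a dictator.\<close>
  ultimately have "?n / 2 * k < ?n + (real k - 2) / 2 * ?n"
    by linarith
  then show False
    by (simp add: left_diff_distrib diff_divide_distrib)
qed

end
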